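(* For all positive integers $n$, one can construct a graph $G_n$ with $n$ vertices such that the extension complexity of the stable set polytope $\mathrm{STAB}(G_n)$ is $2^{\Omega(\sqrt{n})}$.
   Context: Graphs are finite, simple and undirected. A stable set of a graph $G=(V,E)$ is a subset of $V$ no two elements of which are adjacent. For $S\subseteq V$, $\chi^S\in\mathbb{R}^V$ is the characteristic vector of $S$. The stable set polytope is $\mathrm{STAB}(G)=\operatorname{conv}\{\chi^S\in\mathbb{R}^V\mid S \text{ is a stable set of } G\}$. An extended formulation (EF) of a polytope $P \subseteq \mathbb{R}^d$ is a linear system $E^{=}x + F^{=}y = g^{=},\ E^{\leqslant}x + F^{\leqslant}y \leqslant g^{\leqslant}$ in variables $(x,y)\in\mathbb{R}^{d+k}$ (for some $k \geqslant 0$), with real matrices and real vectors as coefficients, such that $x\in P$ if and only if there exists $y\in\mathbb{R}^k$ such that $(x,y)$ satisfies the system. The size of an EF is its number of inequalities (equalities are not counted). The extension complexity of $P$ is the minimum size of an EF of $P$. "The extension complexity of $\mathrm{STAB}(G_n)$ is $2^{\Omega(\sqrt n)}$" means: there is a constant $c>0$, independent of $n$, such that it is at least $2^{c\sqrt n}$ for all sufficiently large $n$. *)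

theory Defs
  imports "HOL-Analysis.Analysis" "HOL-Analysis.Finite_Function_Topology"
    "Graph_Theory.Pair_Digraph"
begin

text \<open>
  The space \<open>\<real>\<^sup>I\<close> is the subspace of the real vector space of finitely supported functions
  consisting of the functions that vanish outside \<open>I\<close>; \<open>\<real>\<^sup>k\<close> is \<open>\<real>\<^sup>I\<close> for \<open>I = {..<k}\<close>.
  The index set can thus depend on a natural number, and the convex hull is the one of
  the library.
\<close>

definition coord_space :: "'i set \<Rightarrow> ('i \<Rightarrow>\<^sub>0 real) set" where
  "coord_space I = {x. Poly_Mapping.keys x \<subseteq> I}"

text \<open>\<open>S\<close> is meant to be finite.\<close>

definition char_vec :: "'i set \<Rightarrow> ('i \<Rightarrow>\<^sub>0 real)" where
  "char_vec S = (\<Sum>v\<in>S. Poly_Mapping.single v 1)"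

lemma lookup_char_vec:
  assumes "finite S"
  shows "Poly_Mapping.lookup (char_vec S) v = (if v \<in> S then 1 else 0)"
  using assms by (simp add: char_vec_def lookup_sum lookup_single when_def)

lemma lookup_scaleR [simp]:
  fixes x :: "'i \<Rightarrow>\<^sub>0 real"
  shows "Poly_Mapping.lookup (c *\<^sub>R x) i = c * Poly_Mapping.lookup x i"
proof -
  have "finite {i. c *\<^sub>R Poly_Mapping.lookup x i \<noteq> 0}"
    by (rule finite_subset[OF _ finite_lookup[of x]]) auto
  then show ?thesis
    by (simp add: scaleR_poly_mapping_def)
qed

text \<open>
  A finite simple undirected graph is a \<open>pair_graph\<close>: a finite vertex set with a symmetric and
  irreflexive adjacency relation \<open>parcs G\<close> on it.
\<close>

definition stable_set :: "'v pair_pre_digraph \<Rightarrow> 'v set \<Rightarrow> bool" where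
  "stable_set G S \<longleftrightarrow> S \<subseteq> pverts G \<and> (\<forall>u\<in>S. \<forall>v\<in>S. (u, v) \<notin> parcs G)"

definition STAB :: "'v pair_pre_digraph \<Rightarrow> ('v \<Rightarrow>\<^sub>0 real) set" where
  "STAB G = convex hull {char_vec S |S. stable_set G S}"

text \<open>
  A linear system in variables \<open>(x, y)\<close>, where \<open>y\<close> ranges over \<open>\<real>\<^sup>k\<close> with \<open>k = num_aux\<close>, has
  \<open>num_eq\<close> equalities and \<open>num_le\<close> inequalities. Matrix entries beyond these bounds, or in columns
  outside the index set of \<open>x\<close>, are irrelevant.
\<close>

record 'i lin_system =
  num_aux :: nat
  num_eq :: nat
  num_le :: nat
  E_eq :: "nat \<Rightarrow> 'i \<Rightarrow> real"
  F_eq :: "nat \<Rightarrow> nat \<Rightarrow> real"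
  g_eq :: "nat \<Rightarrow> real"
  E_le :: "nat \<Rightarrow> 'i \<Rightarrow> real"
  F_le :: "nat \<Rightarrow> nat \<Rightarrow> real"
  g_le :: "nat \<Rightarrow> real"

definition satisfies ::
  "'i set \<Rightarrow> 'i lin_system \<Rightarrow> ('i \<Rightarrow>\<^sub>0 real) \<Rightarrow> (nat \<Rightarrow>\<^sub>0 real) \<Rightarrow> bool" where
  "satisfies I L x y \<longleftrightarrow>
     (\<forall>j<num_eq L. (\<Sum>i\<in>I. E_eq L j i * Poly_Mapping.lookup x i)
        + (\<Sum>l<num_aux L. F_eq L j l * Poly_Mapping.lookup y l) = g_eq L j) \<and>
     (\<forall>j<num_le L. (\<Sum>i\<in>I. E_le L j i * Poly_Mapping.lookup x i)
        + (\<Sum>l<num_aux L. F_le L j l * Poly_Mapping.lookup y l) \<le> g_le L j)"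

definition extended_formulation :: "'i set \<Rightarrow> ('i \<Rightarrow>\<^sub>0 real) set \<Rightarrow> 'i lin_system \<Rightarrow> bool" where
  "extended_formulation I P L \<longleftrightarrow>
     P \<subseteq> coord_space I \<and>
     (\<forall>x\<in>coord_space I. x \<in> P \<longleftrightarrow> (\<exists>y\<in>coord_space {..<num_aux L}. satisfies I L x y))"

definition extension_complexity :: "'i set \<Rightarrow> ('i \<Rightarrow>\<^sub>0 real) set \<Rightarrow> nat" where
  "extension_complexity I P = (LEAST r. \<exists>L. extended_formulation I P L \<and> num_le L = r)"

text \<open>The minimum is attained, so the unspecified case of \<open>LEAST\<close> does not occur for polytopes.\<close>

lemma ex_extended_formulation:
  fixes X :: "('i \<Rightarrow>\<^sub>0 real) set"
  assumes I: "finite I" and X: "finite X" "X \<subseteq> coord_space I"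
  shows "\<exists>L. extended_formulation I (convex hull X) L"
proof -
  obtain h where h: "bij_betw h {..<card X} X"
    using X(1) by (metis atLeast0LessThan ex_bij_betw_nat_finite)
  obtain e where e: "bij_betw e {..<card I} I"
    using I by (metis atLeast0LessThan ex_bij_betw_nat_finite)
  define k where "k = card X"
  define d where "d = card I"
  note he = h[folded k_def] e[folded d_def]
  define L where "L = \<lparr>num_aux = k, num_eq = Suc d, num_le = k,
     E_eq = (\<lambda>j i. if j < d \<and> e j = i then - 1 else 0),
     F_eq = (\<lambda>j l. if j < d then Poly_Mapping.lookup (h l) (e j) else 1),
     g_eq = (\<lambda>j. if j < d then 0 else 1),
     E_le = (\<lambda>j i. 0), F_le = (\<lambda>j l. if j = l then - 1 else 0), g_le = (\<lambda>j. 0)\<rparr>"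
  have eI: "j < d \<Longrightarrow> e j \<in> I" for j using he(2) by (auto simp: bij_betw_def)
  have sat: "satisfies I L x y \<longleftrightarrow>
      (\<forall>i\<in>I. (\<Sum>l<k. Poly_Mapping.lookup (h l) i * Poly_Mapping.lookup y l)
        = Poly_Mapping.lookup x i) \<and>
      (\<Sum>l<k. Poly_Mapping.lookup y l) = 1 \<and> (\<forall>l<k. Poly_Mapping.lookup y l \<ge> 0)" for x y
  proof -
    have s: "(\<Sum>i\<in>I. E_eq L j i * Poly_Mapping.lookup x i)
        = (if j < d then - Poly_Mapping.lookup x (e j) else 0)" for j
      using I eI by (auto simp: L_def if_distrib[of "\<lambda>t. t * _"] cong: if_cong)
    have t: "(\<Sum>l<num_aux L. F_eq L j l * Poly_Mapping.lookup y l)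
        = (if j < d then \<Sum>l<k. Poly_Mapping.lookup (h l) (e j) * Poly_Mapping.lookup y l
           else \<Sum>l<k. Poly_Mapping.lookup y l)" for j
      by (simp add: L_def)
    have s': "(\<Sum>i\<in>I. E_le L j i * Poly_Mapping.lookup x i) = 0" for j
      by (simp add: L_def)
    have t': "(\<Sum>l<num_aux L. F_le L j l * Poly_Mapping.lookup y l)
        = - Poly_Mapping.lookup y j" if "j < k" for j
      using that by (simp add: L_def if_distrib[of "\<lambda>t. t * _"] cong: if_cong)
    have b: "(\<forall>i\<in>I. Q i) \<longleftrightarrow> (\<forall>j<d. Q (e j))" for Q
      using he(2) by (auto simp: bij_betw_def)
    have n: "num_eq L = Suc d" "num_le L = k" "g_eq L = (\<lambda>j. if j < d then 0 else 1)"
      "g_le L = (\<lambda>j. 0)"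
      by (simp_all add: L_def)
    show ?thesis
      unfolding satisfies_def b s t s' n by (auto simp: t' less_Suc_eq all_conj_distrib)
  qed
  have sub: "convex hull X \<subseteq> coord_space I"
  proof (rule hull_minimal[OF X(2)])
    show "convex (coord_space I :: ('i \<Rightarrow>\<^sub>0 real) set)"
      by (auto simp: convex_def coord_space_def in_keys_iff lookup_add subset_iff)
         (metis add.right_neutral mult_zero_right)
  qed
  have "x \<in> convex hull X \<longleftrightarrow> (\<exists>y\<in>coord_space {..<k}. satisfies I L x y)"
    if x: "x \<in> coord_space I" for x
  proof
    assume "x \<in> convex hull X"
    then obtain u where u: "\<forall>v\<in>X. 0 \<le> u v" "sum u X = 1" "(\<Sum>v\<in>X. u v *\<^sub>R v) = x"
      unfolding convex_hull_finite[OF X(1)] by auto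
    define y where "y = (\<Sum>l<k. Poly_Mapping.single l (u (h l)))"
    have y: "Poly_Mapping.lookup y l = (if l < k then u (h l) else 0)" for l
      by (simp add: y_def lookup_sum lookup_single when_def)
    have hX: "l < k \<Longrightarrow> h l \<in> X" for l using he(1) by (auto simp: bij_betw_def)
    have "(\<Sum>l<k. Poly_Mapping.lookup (h l) i * Poly_Mapping.lookup y l)
        = Poly_Mapping.lookup x i" for i
    proof -
      have "Poly_Mapping.lookup x i = (\<Sum>v\<in>X. u v * Poly_Mapping.lookup v i)"
        by (simp flip: u(3) add: lookup_sum)
      also have "\<dots> = (\<Sum>l<k. u (h l) * Poly_Mapping.lookup (h l) i)"
        by (rule sum.reindex_bij_betw[OF he(1), symmetric])
      finally show ?thesis by (simp add: y mult.commute)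
    qed
    moreover have "(\<Sum>l<k. Poly_Mapping.lookup y l) = 1"
      using sum.reindex_bij_betw[OF he(1), of u] u(2) by (simp add: y)
    moreover have "y \<in> coord_space {..<k}"
      by (auto simp: coord_space_def in_keys_iff y split: if_splits)
    ultimately show "\<exists>y\<in>coord_space {..<k}. satisfies I L x y"
      using u(1) hX by (intro bexI[of _ y]) (auto simp: sat y)
  next
    assume "\<exists>y\<in>coord_space {..<k}. satisfies I L x y"
    then obtain y where y: "\<forall>i\<in>I. (\<Sum>l<k. Poly_Mapping.lookup (h l) i * Poly_Mapping.lookup y l)
        = Poly_Mapping.lookup x i"
      "(\<Sum>l<k. Poly_Mapping.lookup y l) = 1" "\<forall>l<k. Poly_Mapping.lookup y l \<ge> 0"
      unfolding sat by auto
    have hX: "l < k \<Longrightarrow> h l \<in> X" for l using he(1) by (auto simp: bij_betw_def)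
    have "(\<Sum>l<k. Poly_Mapping.lookup y l *\<^sub>R h l) \<in> convex hull X"
      using y hX by (intro convex_sum convex_convex_hull) (auto intro: hull_inc)
    moreover have "(\<Sum>l<k. Poly_Mapping.lookup y l *\<^sub>R h l) = x"
    proof (rule poly_mapping_eqI)
      fix i
      have "Poly_Mapping.lookup (h l) i = 0" if "l < k" "i \<notin> I" for l
        using that hX X(2) by (fastforce simp: coord_space_def in_keys_iff)
      moreover have "Poly_Mapping.lookup x i = 0" if "i \<notin> I"
        using that x by (auto simp: coord_space_def in_keys_iff)
      ultimately show "Poly_Mapping.lookup (\<Sum>l<k. Poly_Mapping.lookup y l *\<^sub>R h l) i
          = Poly_Mapping.lookup x i"
        using y(1) by (cases "i \<in> I") (auto simp: lookup_sum mult.commute)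
    qed
    ultimately show "x \<in> convex hull X" by simp
  qed
  then show ?thesis
    using sub unfolding extended_formulation_def by (intro exI[of _ L]) (simp add: L_def)
qed

end

theory Submission
  imports Defs "HOL-Real_Asymp.Real_Asymp" "HOL-Library.Nat_Bijection"
begin

text \<open>
  Read pairs \<open>(i, j)\<close> of natural numbers as partial assignments that are adjacent when they
  contradict each other; the \<open>n\<close>-vertex graph is induced by the first \<open>n\<close> pairs in the order of
  \<open>prod_encode\<close>. If it contains all pairs with \<open>i, j < m\<close>, every \<open>b \<subseteq> {..<m}\<close> gives a stable set, and every
  \<open>a \<subseteq> {..<m}\<close> gives a valid inequality whose slack at that stable set is
  \<open>(1 - card (a \<inter> b))\<^sup>2\<close>. Each inequality of an extended formulation yields a rectangle
  of pairs \<open>(a, b)\<close> that contains no pair with \<open>card (a \<inter> b) = 1\<close>, and (up to one extra rectangle)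
  these cover all \<open>3 ^ m\<close> disjoint pairs. By the argument of Kaibel and Weltge such a rectangle
  contains at most \<open>2 ^ m\<close> disjoint pairs, so at least \<open>(3 / 2) ^ m\<close> rectangles are needed. Here
  \<open>m\<close> can be taken of order \<open>sqrt n\<close>.
\<close>

section \<open>Counting disjoint pairs in rectangles\<close>

text \<open>Induction over \<open>X\<close>: two classes cover the disjoint pairs, and deleting
  \<open>x\<close> maps each injectively into the disjoint pairs of a rectangle over the smaller set
  that again avoids intersections of size one. So a new element at most doubles the count.\<close>

lemma card_disjoint_pairs_rectangle_le:
  assumes "finite X" "A \<subseteq> Pow X" "B \<subseteq> Pow X"
    and "\<And>a b. a \<in> A \<Longrightarrow> b \<in> B \<Longrightarrow> card (a \<inter> b) \<noteq> 1"
  shows "card {(a, b) \<in> A \<times> B. a \<inter> b = {}} \<le> 2 ^ card X"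
  using assms
proof (induction X arbitrary: A B rule: finite_induct)
  case empty
  then have "{(a, b) \<in> A \<times> B. a \<inter> b = {}} \<subseteq> {({}, {})}" by auto
  from card_mono[OF _ this] show ?case by simp
next
  case (insert x X)
  define D where "D A B = {(a, b) \<in> A \<times> B. a \<inter> b = {}}" for A B :: "'a set set"
  define \<phi> where "\<phi> = (\<lambda>(a, b). (a - {x}, b - {x}) :: 'a set \<times> 'a set)"
  define A0 where "A0 = {a \<in> A. x \<notin> a}"
  define A1 where "A1 = (\<lambda>a. a - {x}) ` A"
  define B0 where "B0 = {b \<in> B. x \<notin> b}"
  define B1 where "B1 = (\<lambda>b. b - {x}) ` B"
  \<comment> \<open>A disjoint pair over \<open>X\<close> extends in three ways to a disjoint pair over \<open>insert x X\<close>, but at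
    most two of them lie in the rectangle, since \<open>(insert x a, insert x b)\<close> does not.\<close>
  define DL where "DL = {(a, b) \<in> D A B. x \<in> a \<or> x \<notin> b \<and> insert x a \<notin> A}"
  define DR where "DR = {(a, b) \<in> D A B. x \<in> b \<or> x \<notin> a \<and> insert x a \<in> A}"
  have fin: "finite A" "finite B"
    using insert.prems insert.hyps(1) by (meson finite_Pow_iff finite_insert finite_subset)+
  have "finite (D A' B')" if "finite A'" "finite B'" for A' B'
    by (rule finite_subset[of _ "A' \<times> B'"]) (use that in \<open>auto simp: D_def\<close>)
  then have finD: "finite (D A1 B0)" "finite (D A0 B1)"
    using fin by (simp_all add: A0_def A1_def B0_def B1_def)
  have "card (D A1 B0) \<le> 2 ^ card X"
    unfolding D_def
  proof (rule insert.IH)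
    show "A1 \<subseteq> Pow X" "B0 \<subseteq> Pow X" using insert.prems by (auto simp: A1_def B0_def)
    fix a b assume "a \<in> A1" "b \<in> B0"
    then obtain a' where a': "a' \<in> A" "a = a' - {x}" "b \<in> B" "x \<notin> b"
      by (auto simp: A1_def B0_def)
    then have "a \<inter> b = a' \<inter> b" by auto
    then show "card (a \<inter> b) \<noteq> 1" using insert.prems(3) a' by simp
  qed
  moreover have "card (D A0 B1) \<le> 2 ^ card X"
    unfolding D_def
  proof (rule insert.IH)
    show "A0 \<subseteq> Pow X" "B1 \<subseteq> Pow X" using insert.prems by (auto simp: A0_def B1_def)
    fix a b assume "a \<in> A0" "b \<in> B1"
    then obtain b' where b': "b' \<in> B" "b = b' - {x}" "a \<in> A" "x \<notin> a"
      by (auto simp: A0_def B1_def)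
    then have "a \<inter> b = a \<inter> b'" by auto
    then show "card (a \<inter> b) \<noteq> 1" using insert.prems(3) b' by simp
  qed
  moreover have "card DL \<le> card (D A1 B0)"
  proof (rule card_inj_on_le[where f = \<phi>])
    show "inj_on \<phi> DL"
    proof (rule inj_onI, clarify)
      fix a b a' b'
      assume 1: "(a, b) \<in> DL" "(a', b') \<in> DL" "\<phi> (a, b) = \<phi> (a', b')"
      then have b: "x \<notin> b" "x \<notin> b'" and e: "a - {x} = a' - {x}" "b - {x} = b' - {x}"
        by (auto simp: DL_def D_def \<phi>_def)
      \<comment> \<open>If they differed in \<open>x\<close>, adding \<open>x\<close> to the one
        without it would give the other, which lies in \<open>A\<close>; membership in
        \<open>DL\<close> excludes this.\<close>
      have "x \<in> a \<longleftrightarrow> x \<in> a'"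
      proof (rule ccontr)
        assume "\<not> (x \<in> a \<longleftrightarrow> x \<in> a')"
        then consider "x \<in> a" "a = insert x a'" "x \<notin> a'" | "x \<in> a'" "a' = insert x a" "x \<notin> a"
          using e by blast
        then show False by cases (use 1 in \<open>auto simp: DL_def D_def\<close>)
      qed
      then show "a = a' \<and> b = b'" using e b by blast
    qed
    show "\<phi> ` DL \<subseteq> D A1 B0"
    proof (rule image_subsetI, clarify)
      fix a b assume ab: "(a, b) \<in> DL"
      then have "x \<notin> b" by (auto simp: DL_def D_def)
      then have "b - {x} = b" by simp
      then show "\<phi> (a, b) \<in> D A1 B0"
        using ab \<open>x \<notin> b\<close> by (auto simp: DL_def D_def \<phi>_def A1_def B0_def)
    qed
  qed (rule finD)
  moreover have "card DR \<le> card (D A0 B1)"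
  proof (rule card_inj_on_le[where f = \<phi>])
    \<comment> \<open>This makes \<open>\<phi>\<close> injective on \<open>DR\<close>: for one
      \<open>a\<close>, a set without \<open>x\<close> and the same set with \<open>x\<close> cannot
      both occur as \<open>b\<close>.\<close>
    have no: "b \<notin> B" if "x \<in> b" "insert x a \<in> A" "a \<inter> b = {}" for a b
    proof
      assume "b \<in> B"
      moreover have "insert x a \<inter> b = {x}" using that by auto
      ultimately show False using insert.prems(3)[of "insert x a" b] that by simp
    qed
    show "inj_on \<phi> DR"
    proof (rule inj_onI, clarify)
      fix a b a' b'
      assume 1: "(a, b) \<in> DR" "(a', b') \<in> DR" "\<phi> (a, b) = \<phi> (a', b')"
      then have a: "x \<notin> a" "x \<notin> a'" and e: "a = a'" "b - {x} = b' - {x}"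
        by (auto simp: DR_def D_def \<phi>_def)
      have "x \<in> b \<longleftrightarrow> x \<in> b'"
        using 1 e no by (auto simp: DR_def D_def)
      then show "a = a' \<and> b = b'" using e by blast
    qed
    show "\<phi> ` DR \<subseteq> D A0 B1"
    proof (rule image_subsetI, clarify)
      fix a b assume ab: "(a, b) \<in> DR"
      then have "x \<notin> a" by (auto simp: DR_def D_def)
      then have "a - {x} = a" by simp
      then show "\<phi> (a, b) \<in> D A0 B1"
        using ab \<open>x \<notin> a\<close> by (auto simp: DR_def D_def \<phi>_def A0_def B1_def)
    qed
  qed (rule finD)
  moreover have "card (D A B) \<le> card DL + card DR"
  proof -
    have "D A B = DL \<union> DR" by (auto simp: DL_def DR_def D_def)
    then show ?thesis by (simp add: card_Un_le)
  qed
  ultimately show ?case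
    using insert.hyps by (simp add: D_def)
qed

lemma card_disjoint_pairs:
  assumes "finite X"
  shows "card {(a, b) \<in> Pow X \<times> Pow X. a \<inter> b = {}} = 3 ^ card X"
proof -
  have "{(a, b) \<in> Pow X \<times> Pow X. a \<inter> b = {}} = (SIGMA a:Pow X. Pow (X - a))" by auto
  also have "card \<dots> = (\<Sum>a\<in>Pow X. 2 ^ card (X - a))"
    using assms by (simp add: card_Pow)
  \<comment> \<open>Expand the product: the factor 1 is taken on \<open>a\<close>, the factor 2 on
    \<open>X - a\<close>.\<close>
  also have "\<dots> = (\<Prod>i\<in>X. 1 + 2)"
    by (subst prod_add[OF assms]) simp
  also have "\<dots> = 3 ^ card X"
    by (simp add: numeral_3_eq_3)
  finally show ?thesis .
qed

text \<open>Each \<open>t\<close> in \<open>T\<close> gives a rectangle, the pairs with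
  \<open>t \<in> J a\<close> and \<open>t \<in> K b\<close>. Each holds few disjoint pairs, so many
  are needed to cover all of them.\<close>

lemma unique_disjointness_cover:
  fixes J K :: "'x set \<Rightarrow> 't set"
  assumes X: "finite X" and T: "finite T"
    and cov: "\<And>a b. a \<subseteq> X \<Longrightarrow> b \<subseteq> X \<Longrightarrow> a \<inter> b = {} \<Longrightarrow> J a \<inter> K b \<inter> T \<noteq> {}"
    and avoid: "\<And>a b. a \<subseteq> X \<Longrightarrow> b \<subseteq> X \<Longrightarrow> card (a \<inter> b) = 1 \<Longrightarrow> J a \<inter> K b \<inter> T = {}"
  shows "3 ^ card X \<le> card T * 2 ^ card X"
proof -
  define R where
    "R t = {(a, b) \<in> {a \<in> Pow X. t \<in> J a} \<times> {b \<in> Pow X. t \<in> K b}. a \<inter> b = {}}" for t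
  have R: "card (R t) \<le> 2 ^ card X" if "t \<in> T" for t
    unfolding R_def using avoid that
    by (intro card_disjoint_pairs_rectangle_le X) blast+
  have "3 ^ card X = card {(a, b) \<in> Pow X \<times> Pow X. a \<inter> b = {}}"
    by (rule card_disjoint_pairs[OF X, symmetric])
  also have "\<dots> \<le> card (\<Union>t\<in>T. R t)"
  proof (rule card_mono)
    have "(\<Union>t\<in>T. R t) \<subseteq> Pow X \<times> Pow X" by (auto simp: R_def)
    then show "finite (\<Union>t\<in>T. R t)" by (rule finite_subset) (simp add: X)
    show "{(a, b) \<in> Pow X \<times> Pow X. a \<inter> b = {}} \<subseteq> (\<Union>t\<in>T. R t)"
    proof clarify
      fix a b assume *: "a \<subseteq> X" "b \<subseteq> X" "a \<inter> b = {}"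
      from cov[OF *] obtain t where "t \<in> T" "t \<in> J a" "t \<in> K b" by blast
      then show "(a, b) \<in> (\<Union>t\<in>T. R t)" using * by (auto simp: R_def)
    qed
  qed
  also have "\<dots> \<le> (\<Sum>t\<in>T. card (R t))" by (rule card_UN_le[OF T])
  also have "\<dots> \<le> card T * 2 ^ card X" using sum_bounded_above[OF R] by simp
  finally show ?thesis .
qed

section \<open>Faces of polyhedra and extended formulations\<close>

text \<open>Meant for the polyhedron of an extended formulation, with \<open>U\<close> absorbing the
  equalities. Only the zeros of the slacks matter, so active constraints and convexity replace
  linear programming duality.\<close>

lemma face_of_polyhedron_active:
  fixes l :: "'j \<Rightarrow> 'z::real_vector \<Rightarrow> real" and f :: "'z \<Rightarrow> real"
  assumes U: "affine U" and R: "finite R"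
    and lin: "\<And>j. j \<in> R \<Longrightarrow> linear (l j)" "linear f"
    and Q: "Q = {z \<in> U. \<forall>j\<in>R. l j z \<le> h j}"
    and valid: "\<And>z. z \<in> Q \<Longrightarrow> f z \<le> c"
    and face: "z0 \<in> Q" "f z0 = c"
  shows "\<exists>J\<subseteq>R. \<forall>z\<in>Q. f z = c \<longleftrightarrow> (\<forall>j\<in>J. l j z = h j)"
proof -
  define J where "J = {j \<in> R. \<forall>z\<in>Q. f z = c \<longrightarrow> l j z = h j}"
  \<comment> \<open>A point of the face at which only the inequalities in \<open>J\<close> are active: from it, one can move a
    little away from any point \<open>z\<close> of \<open>Q\<close> at which \<open>J\<close> is active without leaving \<open>Q\<close>, which forces
    \<open>z\<close> into the face.\<close>
  have "\<exists>q\<in>Q. f q = c \<and> (\<forall>j\<in>R' - J. l j q < h j)" if "R' \<subseteq> R" for R'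
    using finite_subset[OF that R] that
  proof (induction R' rule: finite_induct)
    case empty
    then show ?case using face by auto
  next
    case (insert j R')
    then obtain q where q: "q \<in> Q" "f q = c" "\<forall>j\<in>R' - J. l j q < h j" by auto
    show ?case
    proof (cases "j \<in> J")
      case True
      then show ?thesis using q by (intro bexI[of _ q]) auto
    next
      case False
      then obtain p where p: "p \<in> Q" "f p = c" "l j p \<noteq> h j"
        using insert.prems by (auto simp: J_def)
      then have pj: "l j p < h j" using insert.prems Q by force
      \<comment> \<open>An inequality valid at \<open>p\<close> and \<open>q\<close> and strict at
        one of them is strict at their midpoint.\<close>
      define q' where "q' = (1/2) *\<^sub>R p + (1/2) *\<^sub>R q"
      have lq: "l i q' = l i p / 2 + l i q / 2" if "i \<in> R" for i
        using lin(1)[OF that] by (simp add: q'_def linear_add linear_scale)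
      have "f q' = c" using p q lin(2) by (simp add: q'_def linear_add linear_scale)
      moreover have "q' \<in> U"
        unfolding q'_def using U p q Q by (intro mem_affine) auto
      moreover have "l i p \<le> h i" "l i q \<le> h i" if "i \<in> R" for i using p q Q that by auto
      then have "l i q' \<le> h i" if "i \<in> R" for i
        using that by (fastforce simp: lq)
      moreover have "l i q' < h i" if "i \<in> insert j R' - J" for i
      proof -
        have "i \<in> R" using that insert.prems by auto
        moreover have "l i p \<le> h i" "l i q \<le> h i" using \<open>i \<in> R\<close> p q Q by auto
        moreover have "l i p < h i \<or> l i q < h i" using that q(3) pj by auto
        ultimately show ?thesis by (auto simp: lq)
      qed
      ultimately show ?thesis using Q by (intro bexI[of _ q']) auto
    qed
  qed
  then obtain q where q: "q \<in> Q" "f q = c" "\<And>j. j \<in> R - J \<Longrightarrow> l j q < h j" by blast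
  have "f z = c" if z: "z \<in> Q" "\<And>j. j \<in> J \<Longrightarrow> l j z = h j" for z
  proof -
    \<comment> \<open>The inequalities outside \<open>J\<close> are strict at \<open>q\<close> and
      finite in number, so one small \<open>e\<close> serves all.\<close>
    have "\<exists>e>0. \<forall>j\<in>R - J. e * (l j q - l j z) \<le> h j - l j q"
    proof -
      have "\<forall>\<^sub>F e in at_right 0. \<forall>j\<in>R - J. e * (l j q - l j z) < h j - l j q"
      proof (rule eventually_ball_finite; (intro ballI)?)
        fix j assume "j \<in> R - J"
        have "((\<lambda>e. e * (l j q - l j z)) \<longlongrightarrow> 0 * (l j q - l j z)) (at_right 0)"
          by (intro tendsto_intros)
        then show "\<forall>\<^sub>F e in at_right 0. e * (l j q - l j z) < h j - l j q"
          by (rule order_tendstoD) (use q(3)[OF \<open>j \<in> R - J\<close>] in simp)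
      qed (use R in auto)
      moreover have "\<forall>\<^sub>F e in at_right 0. e > (0::real)" by (rule eventually_at_right_less)
      ultimately have "\<forall>\<^sub>F e in at_right 0. e > 0 \<and>
          (\<forall>j\<in>R - J. e * (l j q - l j z) < h j - l j q)"
        by eventually_elim auto
      from eventually_happens'[OF _ this] show ?thesis by (auto intro: less_imp_le)
    qed
    then obtain e where e: "e > 0" "\<And>j. j \<in> R - J \<Longrightarrow> e * (l j q - l j z) \<le> h j - l j q"
      by blast
    define p where "p = (1 + e) *\<^sub>R q + (- e) *\<^sub>R z"
    have "p \<in> U" unfolding p_def using U q(1) z(1) Q by (intro mem_affine) auto
    moreover have "l j p \<le> h j" if "j \<in> R" for j
    proof -
      have lp: "l j p = l j q + e * (l j q - l j z)"
        unfolding p_def linear_add[OF lin(1)[OF that]] linear_scale[OF lin(1)[OF that]]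
        by (simp add: algebra_simps)
      show ?thesis
      proof (cases "j \<in> J")
        case True
        then have "l j q = h j" using q by (auto simp: J_def)
        then show ?thesis using z(2)[OF True] lp by simp
      next
        case False
        then show ?thesis using e(2)[of j] that lp by simp
      qed
    qed
    ultimately have "f p \<le> c" using valid Q by auto
    moreover have "f p = c + e * (c - f z)"
      unfolding p_def linear_add[OF lin(2)] linear_scale[OF lin(2)] q(2)
      by (simp add: algebra_simps)
    ultimately have "e * (c - f z) \<le> 0" by simp
    then have "c \<le> f z" using e(1) by (simp add: mult_le_0_iff)
    then show "f z = c" using valid[OF z(1)] by simp
  qed
  then show ?thesis by (intro exI[of _ J]) (auto simp: J_def)
qed

lemma linear_sum_lookup:
  "linear (\<lambda>x. \<Sum>i\<in>I. w i * Poly_Mapping.lookup x i :: real)"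
  by (rule linearI) (simp_all add: lookup_add sum.distrib sum_distrib_left algebra_simps)

lemma linear_sum_lookup_pair:
  "linear (\<lambda>(x, y). (\<Sum>i\<in>I. w i * Poly_Mapping.lookup x i) + (\<Sum>l\<in>K. v l * Poly_Mapping.lookup y l) :: real)"
  by (rule linearI) (auto simp: lookup_add sum.distrib sum_distrib_left algebra_simps)

lemma subspace_coord_space: "subspace (coord_space I)"
  by (auto simp: subspace_def coord_space_def in_keys_iff lookup_add subset_iff)
     (metis add.right_neutral)+

text \<open>
  \<open>J\<close> collects the inequalities that are active on a whole face, \<open>K\<close> those that are not active at a
  chosen preimage of a point. Each inequality thus gives a rectangle, on which all slacks are
  positive, and these rectangles cover all positive entries of a slack matrix.
\<close>

lemma extended_formulation_zero_pattern:
  assumes L: "extended_formulation I P L"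
  obtains J :: "('i \<Rightarrow> real) \<Rightarrow> real \<Rightarrow> nat set" and K :: "('i \<Rightarrow>\<^sub>0 real) \<Rightarrow> nat set"
  where "\<And>w c. J w c \<subseteq> {..<num_le L}"
    and "\<And>w c x z. \<lbrakk>\<And>x. x \<in> P \<Longrightarrow> (\<Sum>i\<in>I. w i * Poly_Mapping.lookup x i) \<le> c;
           z \<in> P; (\<Sum>i\<in>I. w i * Poly_Mapping.lookup z i) = c; x \<in> P\<rbrakk>
         \<Longrightarrow> J w c \<inter> K x = {} \<longleftrightarrow> (\<Sum>i\<in>I. w i * Poly_Mapping.lookup x i) = c"
proof -
  define f :: "('i \<Rightarrow> real) \<Rightarrow> ('i \<Rightarrow>\<^sub>0 real) \<Rightarrow> real" where
    "f w x = (\<Sum>i\<in>I. w i * Poly_Mapping.lookup x i)" for w x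
  define le where "le j = (\<lambda>(x, y). (\<Sum>i\<in>I. E_le L j i * Poly_Mapping.lookup x i)
        + (\<Sum>l<num_aux L. F_le L j l * Poly_Mapping.lookup y l))" for j
  define eq where "eq j = (\<lambda>(x, y). (\<Sum>i\<in>I. E_eq L j i * Poly_Mapping.lookup x i)
        + (\<Sum>l<num_aux L. F_eq L j l * Poly_Mapping.lookup y l))" for j
  define C where "C = coord_space I \<times> coord_space {..<num_aux L}"
  define U where "U = {z \<in> C. \<forall>j<num_eq L. eq j z = g_eq L j}"
  define Q where "Q = {z \<in> U. \<forall>j\<in>{..<num_le L}. le j z \<le> g_le L j}"
  have Q_iff: "(x, y) \<in> Q \<longleftrightarrow>
      x \<in> coord_space I \<and> y \<in> coord_space {..<num_aux L} \<and> satisfies I L x y" for x y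
    by (auto simp: Q_def U_def C_def satisfies_def le_def eq_def)
  have P_iff: "x \<in> P \<longleftrightarrow> (\<exists>y. (x, y) \<in> Q)" for x
    using L unfolding extended_formulation_def Q_iff by blast
  have lin: "linear (le j)" "linear (eq j)" for j
    unfolding le_def eq_def by (rule linear_sum_lookup_pair)+
  have "affine U"
    unfolding affine_def
  proof (intro ballI allI impI)
    fix x y and u v :: real assume *: "x \<in> U" "y \<in> U" "u + v = 1"
    have "subspace C"
      unfolding C_def by (intro subspace_Times subspace_coord_space)
    then have "u *\<^sub>R x + v *\<^sub>R y \<in> C"
      using * by (auto simp: U_def intro!: subspace_add subspace_scale)
    moreover have "eq j (u *\<^sub>R x + v *\<^sub>R y) = g_eq L j" if "j < num_eq L" for j
    proof -
      have "eq j (u *\<^sub>R x + v *\<^sub>R y) = u * g_eq L j + v * g_eq L j"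
        using * that by (simp add: linear_add[OF lin(2)] linear_scale[OF lin(2)] U_def)
      then show ?thesis using *(3) by (metis distrib_right mult_1)
    qed
    ultimately show "u *\<^sub>R x + v *\<^sub>R y \<in> U" by (simp add: U_def)
  qed
  \<comment> \<open>The premise inside makes the claim total in \<open>w\<close> and
    \<open>c\<close>, so that \<open>J\<close> can be chosen as a function.\<close>
  have "\<exists>J\<subseteq>{..<num_le L}. (\<forall>x\<in>P. f w x \<le> c) \<and> (\<exists>z\<in>P. f w z = c) \<longrightarrow>
      (\<forall>z\<in>Q. f w (fst z) = c \<longleftrightarrow> (\<forall>j\<in>J. le j z = g_le L j))" for w c
  proof (cases "(\<forall>x\<in>P. f w x \<le> c) \<and> (\<exists>z\<in>P. f w z = c)")
    case True
    then obtain z0 where z0: "z0 \<in> Q" "f w (fst z0) = c" using P_iff by fastforce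
    have "\<exists>J\<subseteq>{..<num_le L}. \<forall>z\<in>Q. f w (fst z) = c \<longleftrightarrow> (\<forall>j\<in>J. le j z = g_le L j)"
    proof (rule face_of_polyhedron_active[where f = "\<lambda>z. f w (fst z)" and l = le,
            OF \<open>affine U\<close> _ lin(1) _ Q_def _ z0])
      show "linear (\<lambda>z. f w (fst z))"
        using linear_compose[OF linear_fst linear_sum_lookup[of w I]] by (simp add: o_def f_def)
      show "f w (fst z) \<le> c" if "z \<in> Q" for z
        using True P_iff that by (metis prod.collapse)
    qed simp
    then show ?thesis by blast
  next
    case False
    then show ?thesis by blast
  qed
  then obtain J where J: "\<And>w c. J w c \<subseteq> {..<num_le L}"
    "\<And>w c z. (\<forall>x\<in>P. f w x \<le> c) \<Longrightarrow> (\<exists>z\<in>P. f w z = c) \<Longrightarrow> z \<in> Q \<Longrightarrow>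
      f w (fst z) = c \<longleftrightarrow> (\<forall>j\<in>J w c. le j z = g_le L j)"
    by metis
  \<comment> \<open>The objective depends on \<open>x\<close> alone, so one lift of each point
    serves for all faces.\<close>
  obtain y where y: "\<And>x. x \<in> P \<Longrightarrow> (x, y x) \<in> Q" using P_iff by metis
  show ?thesis
  proof (rule that[of J "\<lambda>x. {j. le j (x, y x) \<noteq> g_le L j}", folded f_def])
    show "J w c \<subseteq> {..<num_le L}" for w c by (rule J)
    fix w c x z
    assume *: "\<And>x. x \<in> P \<Longrightarrow> f w x \<le> c" "z \<in> P" "f w z = c" "x \<in> P"
    then have "f w x = c \<longleftrightarrow> (\<forall>j\<in>J w c. le j (x, y x) = g_le L j)"
      using J(2)[of w c "(x, y x)"] y by auto
    then show "J w c \<inter> {j. le j (x, y x) \<noteq> g_le L j} = {} \<longleftrightarrow> f w x = c" by auto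
  qed
qed

section \<open>Partial assignments and the unique disjointness slacks\<close>

text \<open>
  The pair \<open>(i, j)\<close> stands for the partial assignment \<open>i \<in> b\<close>, \<open>j \<notin> b\<close> if \<open>i \<noteq> j\<close>, and for
  \<open>i \<notin> b\<close> if \<open>i = j\<close>; edges join contradictory assignments.
\<close>

fun contradictory :: "'a \<times> 'a \<Rightarrow> 'a \<times> 'a \<Rightarrow> bool" where
  "contradictory (i, j) (k, l) \<longleftrightarrow> i \<noteq> j \<and> i = l \<or> k \<noteq> l \<and> k = j"

text \<open>The pairs whose assignment \<open>b\<close> satisfies: arcs leaving \<open>b\<close>,
  and loops outside \<open>b\<close>.\<close>

definition cut_pairs :: "'a set \<Rightarrow> ('a \<times> 'a) set" where
  "cut_pairs b = {(i, j). j \<notin> b \<and> (i \<in> b \<or> i = j)}"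

text \<open>The loop weight is chosen to make the slack at \<open>cut_pairs b\<close> the square of
  \<open>card (a \<inter> b) - 1\<close>.\<close>

definition weight :: "'a set \<Rightarrow> 'a \<times> 'a \<Rightarrow> real" where
  "weight a = (\<lambda>(i, j). if i \<in> a \<and> j \<in> a then if i = j then real (card a) - 2 else 1 else 0)"

lemma not_contradictory_cut_pairs: "p \<in> cut_pairs b \<Longrightarrow> q \<in> cut_pairs b \<Longrightarrow> \<not> contradictory p q"
  by (cases p; cases q) (auto simp: cut_pairs_def)

text \<open>Without contradictions all demands of \<open>T\<close> can be met at once, by putting
  into the set exactly what \<open>T\<close> demands to be in it.\<close>

lemma subset_cut_pairs:
  assumes "\<And>p q. p \<in> T \<Longrightarrow> q \<in> T \<Longrightarrow> \<not> contradictory p q"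
  shows "T \<subseteq> cut_pairs {i. \<exists>j. j \<noteq> i \<and> (i, j) \<in> T}"
proof clarify
  fix i j assume ij: "(i, j) \<in> T"
  \<comment> \<open>Otherwise \<open>(j, k)\<close> would demand \<open>j\<close> in the set while
    \<open>(i, j)\<close> demands it out.\<close>
  then have "k = j" if "(j, k) \<in> T" for k
    using assms[OF that ij] by auto
  then show "(i, j) \<in> cut_pairs {i. \<exists>j. j \<noteq> i \<and> (i, j) \<in> T}"
    using ij unfolding cut_pairs_def mem_Collect_eq case_prod_conv by metis
qed

text \<open>With k = \<open>card a\<close> and s = \<open>card (a \<inter> b)\<close> there are s(k
  - s) arcs of weight 1 and k - s loops of weight k - 2. The total (k - s)(k + s - 2) is a
  difference of squares.\<close>

lemma sum_weight_cut_pairs: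
  assumes "finite a"
  shows "(\<Sum>p\<in>cut_pairs b \<inter> a \<times> a. weight a p)
    = (real (card a) - 1)\<^sup>2 - (real (card (a \<inter> b)) - 1)\<^sup>2"
proof -
  define s where "s = card (a \<inter> b)"
  define k where "k = card a"
  have c: "card (a - b) = k - s" "s \<le> k"
    using assms by (auto simp: s_def k_def card_Diff_subset_Int card_mono)
  have eq: "cut_pairs b \<inter> a \<times> a = (a \<inter> b) \<times> (a - b) \<union> (\<lambda>i. (i, i)) ` (a - b)"
    by (auto simp: cut_pairs_def)
  have "(\<Sum>p\<in>cut_pairs b \<inter> a \<times> a. weight a p)
      = (\<Sum>p\<in>(a \<inter> b) \<times> (a - b). weight a p) + (\<Sum>p\<in>(\<lambda>i. (i, i)) ` (a - b). weight a p)"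
    unfolding eq using assms by (intro sum.union_disjoint) auto
  also have "(\<Sum>p\<in>(a \<inter> b) \<times> (a - b). weight a p) = (\<Sum>p\<in>(a \<inter> b) \<times> (a - b). 1)"
    by (rule sum.cong) (auto simp: weight_def)
  also have "\<dots> = real s * (real k - real s)"
    using c by (simp add: card_cartesian_product s_def of_nat_diff)
  also have "(\<Sum>p\<in>(\<lambda>i. (i, i)) ` (a - b). weight a p) = (\<Sum>i\<in>a - b. real k - 2)"
    by (subst sum.reindex) (auto simp: inj_on_def weight_def k_def)
  also have "\<dots> = (real k - real s) * (real k - 2)"
    using c by (simp add: of_nat_diff)
  finally show ?thesis
    unfolding s_def[symmetric] k_def[symmetric] by (simp add: power2_eq_square algebra_simps)
qed

lemma sum_weight_le:
  assumes a: "finite a" and T: "finite T" "\<And>p q. p \<in> T \<Longrightarrow> q \<in> T \<Longrightarrow> \<not> contradictory p q"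
  shows "(\<Sum>p\<in>T. weight a p) \<le> (real (card a) - 1)\<^sup>2"
proof -
  have "(\<Sum>p\<in>T. weight a p) = (\<Sum>p\<in>T \<inter> a \<times> a. weight a p)"
    using T(1) by (intro sum.mono_neutral_right) (auto simp: weight_def split: if_splits)
  also have "\<dots> \<le> (real (card a) - 1)\<^sup>2"
  \<comment> \<open>For \<open>card a = 1\<close> the loop weight is negative, so enlarging
    \<open>T\<close> is safe only from 2 on; below that, no weight is positive.\<close>
  proof (cases "card a \<ge> 2")
    case True
    obtain b where "T \<subseteq> cut_pairs b" using subset_cut_pairs[OF T(2)] by blast
    then have "(\<Sum>p\<in>T \<inter> a \<times> a. weight a p) \<le> (\<Sum>p\<in>cut_pairs b \<inter> a \<times> a. weight a p)"
      using a True by (intro sum_mono2) (auto simp: weight_def)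
    also have "\<dots> \<le> (real (card a) - 1)\<^sup>2"
      unfolding sum_weight_cut_pairs[OF a] by simp
    finally show ?thesis .
  next
    case False
    then have "i = j" if "i \<in> a" "j \<in> a" for i j
      using that a card_le_Suc0_iff_eq[OF a] by auto
    then have "(\<Sum>p\<in>T \<inter> a \<times> a. weight a p) \<le> 0"
      using False by (intro sum_nonpos) (auto simp: weight_def)
    also have "0 \<le> (real (card a) - 1)\<^sup>2" by simp
    finally show ?thesis .
  qed
  finally show ?thesis .
qed

section \<open>The conflict graphs and their stable set polytopes\<close>

definition conflict_graph :: "nat \<Rightarrow> nat pair_pre_digraph" where
  "conflict_graph n = \<lparr>pverts = {..<n},
     parcs = {(u, v). u < n \<and> v < n \<and> contradictory (prod_decode u) (prod_decode v)}\<rparr>"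

lemma pverts_conflict_graph [simp]: "pverts (conflict_graph n) = {..<n}"
  by (simp add: conflict_graph_def)

lemma contradictory_sym: "contradictory p q \<Longrightarrow> contradictory q p"
  by (cases p; cases q) auto

lemma contradictory_irrefl: "\<not> contradictory p p"
  by (cases p) auto

lemma pair_graph_conflict_graph: "pair_graph (conflict_graph n)"
proof
  show "finite (parcs (conflict_graph n))"
    by (rule finite_subset[of _ "{..<n} \<times> {..<n}"]) (auto simp: conflict_graph_def)
qed (auto simp: conflict_graph_def symmetric_def sym_def contradictory_sym contradictory_irrefl)

lemma stable_set_conflict_graph:
  "stable_set (conflict_graph n) S \<longleftrightarrow>
     S \<subseteq> {..<n} \<and> (\<forall>u\<in>S. \<forall>v\<in>S. \<not> contradictory (prod_decode u) (prod_decode v))"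
  by (auto simp: stable_set_def conflict_graph_def)

text \<open>Codes of pairs with coordinate sum d lie below the triangular number of d + 1, and here
  d + 1 is at most \<open>2 * m\<close>.\<close>

lemma prod_encode_less:
  assumes "i < m" "j < m"
  shows "prod_encode (i, j) < (2 * m)\<^sup>2"
proof -
  have "prod_encode (i, j) < triangle (Suc (i + j))"
    by (simp add: prod_encode_def)
  also have "\<dots> \<le> triangle (2 * m)"
    using assms unfolding triangle_def by (intro div_le_mono mult_le_mono) auto
  also have "\<dots> \<le> (2 * m)\<^sup>2"
    by (cases m) (auto simp: triangle_def power2_eq_square)
  finally show ?thesis .
qed

lemma STAB_valid:
  assumes "\<And>S. stable_set G S \<Longrightarrow> (\<Sum>i\<in>I. w i * Poly_Mapping.lookup (char_vec S) i) \<le> (c::real)"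
    and "x \<in> STAB G"
  shows "(\<Sum>i\<in>I. w i * Poly_Mapping.lookup x i) \<le> c"
proof -
  have "convex ((\<lambda>x. \<Sum>i\<in>I. w i * Poly_Mapping.lookup x i) -` {..c})"
    by (intro convex_linear_vimage linear_sum_lookup) simp
  then have "STAB G \<subseteq> (\<lambda>x. \<Sum>i\<in>I. w i * Poly_Mapping.lookup x i) -` {..c}"
    unfolding STAB_def by (rule hull_minimal[rotated]) (use assms(1) in auto)
  then show ?thesis using assms(2) by auto
qed

text \<open>The inequalities of a smallest extended formulation index the covering rectangles; the
  added 1 counts an extra rectangle for \<open>a = {}\<close>.\<close>

lemma extension_complexity_conflict_graph:
  assumes "(2 * m)\<^sup>2 \<le> n"
  shows "3 ^ m \<le> (extension_complexity {..<n} (STAB (conflict_graph n)) + 1) * 2 ^ m"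
proof -
  let ?G = "conflict_graph n"
  have "\<exists>L. extended_formulation {..<n} (STAB ?G) L"
    unfolding STAB_def
  proof (rule ex_extended_formulation)
    have "{char_vec S |S. stable_set ?G S} \<subseteq> char_vec ` Pow {..<n}"
      by (auto simp: stable_set_def)
    then show "finite {char_vec S |S. stable_set ?G S}"
      by (rule finite_subset) simp
    show "{char_vec S |S. stable_set ?G S} \<subseteq> coord_space {..<n}"
    proof clarify
      fix S assume "stable_set ?G S"
      then have "S \<subseteq> {..<n}" by (simp add: stable_set_def)
      moreover from this have "finite S" by (rule finite_subset) simp
      ultimately show "char_vec S \<in> coord_space {..<n}"
        by (auto simp: coord_space_def in_keys_iff lookup_char_vec split: if_splits)
    qed
  qed simp
  then have "\<exists>r L. extended_formulation {..<n} (STAB ?G) L \<and> num_le L = r" by blast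
  from LeastI_ex[OF this] obtain L where L: "extended_formulation {..<n} (STAB ?G) L"
    and r: "num_le L = extension_complexity {..<n} (STAB ?G)"
    unfolding extension_complexity_def by blast
  define w where "w a v = weight a (prod_decode v)" for a v
  define c where "c a = (real (card a) - 1)\<^sup>2" for a :: "nat set"
  \<comment> \<open>The stable set of \<open>b\<close>, cut down to coordinates below
    \<open>m\<close> so that all codes are vertices.\<close>
  define S where "S b = prod_encode ` (cut_pairs b \<inter> {..<m} \<times> {..<m})" for b
  have val: "(\<Sum>v<n. w a v * Poly_Mapping.lookup (char_vec S) v)
      = (\<Sum>p\<in>prod_decode ` S. weight a p)" if "S \<subseteq> {..<n}" for a S
  proof -
    have "finite S" using that by (rule finite_subset) simp
    then have "(\<Sum>v<n. w a v * Poly_Mapping.lookup (char_vec S) v)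
        = (\<Sum>v<n. if v \<in> S then w a v else 0)"
      by (intro sum.cong) (auto simp: lookup_char_vec)
    also have "\<dots> = (\<Sum>v\<in>S. w a v)"
      using that by (simp add: sum.inter_restrict[symmetric] Int_absorb1)
    also have "\<dots> = (\<Sum>p\<in>prod_decode ` S. weight a p)"
      by (subst sum.reindex) (auto simp: w_def inj_on_def)
    finally show ?thesis .
  qed
  have Sn: "S b \<subseteq> {..<n}" for b
    using prod_encode_less[of _ m] assms by (fastforce simp: S_def)
  have slack: "(\<Sum>v<n. w a v * Poly_Mapping.lookup (char_vec (S b)) v)
      = c a - (real (card (a \<inter> b)) - 1)\<^sup>2" if "a \<subseteq> {..<m}" for a b
  proof -
    have fin: "finite a" using that by (rule finite_subset) simp
    have "prod_decode ` S b = cut_pairs b \<inter> {..<m} \<times> {..<m}"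
      by (simp add: S_def image_image)
    moreover have "(\<Sum>p\<in>cut_pairs b \<inter> {..<m} \<times> {..<m}. weight a p) = (\<Sum>p\<in>cut_pairs b \<inter> a \<times> a. weight a p)"
      using that by (intro sum.mono_neutral_right) (auto simp: weight_def split: if_splits)
    ultimately show ?thesis
      unfolding val[OF Sn] by (simp add: sum_weight_cut_pairs[OF fin] c_def)
  qed
  have SP: "char_vec (S b) \<in> STAB ?G" for b
  proof -
    have "stable_set ?G (S b)"
      unfolding stable_set_conflict_graph
      using Sn by (auto simp: S_def intro: not_contradictory_cut_pairs[THEN notE])
    then show ?thesis unfolding STAB_def by (intro hull_inc) auto
  qed
  have valid: "(\<Sum>v<n. w a v * Poly_Mapping.lookup x v) \<le> c a"
    if "a \<subseteq> {..<m}" "x \<in> STAB ?G" for a x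
    using that(2)
  proof (rule STAB_valid[rotated])
    fix S assume S: "stable_set ?G S"
    then have "S \<subseteq> {..<n}" by (simp add: stable_set_def)
    moreover from this have "finite S" by (rule finite_subset) simp
    moreover have "finite a" using that(1) by (rule finite_subset) simp
    ultimately show "(\<Sum>v<n. w a v * Poly_Mapping.lookup (char_vec S) v) \<le> c a"
      using S unfolding c_def stable_set_conflict_graph
      by (subst val) (auto intro!: sum_weight_le)
  qed
  from L obtain J K where JK: "\<And>w c. J w c \<subseteq> {..<num_le L}"
    "\<And>w c x z. \<lbrakk>\<And>x. x \<in> STAB ?G \<Longrightarrow> (\<Sum>v<n. w v * Poly_Mapping.lookup x v) \<le> c;
        z \<in> STAB ?G; (\<Sum>v<n. w v * Poly_Mapping.lookup z v) = c; x \<in> STAB ?G\<rbrakk>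
      \<Longrightarrow> J w c \<inter> K x = {} \<longleftrightarrow> (\<Sum>v<n. w v * Poly_Mapping.lookup x v) = c"
    by (rule extended_formulation_zero_pattern) blast
  have zero: "J (w a) (c a) \<inter> K (char_vec (S b)) = {} \<longleftrightarrow> card (a \<inter> b) = 1"
    if a: "a \<subseteq> {..<m}" "a \<noteq> {}" for a b
  proof -
    \<comment> \<open>The zero pattern needs a point where the inequality is tight: any
      \<open>b\<close> meeting \<open>a\<close> in one element, such as a singleton inside
      \<open>a\<close>.\<close>
    obtain i where "i \<in> a" using a by blast
    then have "(\<Sum>v<n. w a v * Poly_Mapping.lookup (char_vec (S {i})) v) = c a"
      using slack[OF a(1), of "{i}"] by simp
    from JK(2)[OF valid[OF a(1)] SP this SP] show ?thesis
      by (simp add: slack[OF a(1)])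
  qed
  \<comment> \<open>The inequality of \<open>a = {}\<close> is tight nowhere, so its row gets a rectangle of its own.\<close>
  define J' where "J' a = (if a = {} then {num_le L} else J (w a) (c a))" for a
  define K' where "K' b = insert (num_le L) (K (char_vec (S b)))" for b
  \<comment> \<open>The index \<open>num_le L\<close> lies in every \<open>K' b\<close> but in
    \<open>J' a\<close> only for \<open>a = {}\<close>, whose intersections never have size
    one.\<close>
  have J'K': "J' a \<inter> K' b \<inter> {..num_le L} = {} \<longleftrightarrow> card (a \<inter> b) = 1" if "a \<subseteq> {..<m}" for a b
  proof (cases "a = {}")
    case False
    have "J' a \<inter> K' b \<inter> {..num_le L} = J (w a) (c a) \<inter> K (char_vec (S b))"
      using False JK(1)[of "w a" "c a"] by (auto simp: J'_def K'_def)
    then show ?thesis using zero[OF that False] by simp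
  qed (auto simp: J'_def K'_def)
  have "3 ^ card {..<m} \<le> card {..num_le L} * 2 ^ card {..<m}"
    by (rule unique_disjointness_cover[where J = J' and K = K']) (auto simp: J'K')
  then show ?thesis by (simp add: r)
qed

section \<open>The asymptotic bound\<close>

theorem theorem10:
  shows "\<exists>G :: nat \<Rightarrow> nat pair_pre_digraph.
           (\<forall>n>0. pair_graph (G n) \<and> card (pverts (G n)) = n) \<and>
           (\<exists>c::real. c > 0 \<and> (\<forall>\<^sub>F n in sequentially.
              2 powr (c * sqrt (real n))
                \<le> real (extension_complexity (pverts (G n)) (STAB (G n)))))"
proof (intro exI[of _ conflict_graph] conjI allI impI exI[of _ "1/8"])
  show "pair_graph (conflict_graph n)" for n by (rule pair_graph_conflict_graph)
  \<comment> \<open>The right side is the bound reached below, from base \<open>sqrt 2\<close> and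
    \<open>m \<ge> sqrt n / 2 - 1\<close>. Its exponent grows like \<open>sqrt n / 4\<close>, which
    leaves room for 1/8.\<close>
  have "\<forall>\<^sub>F n in sequentially. 2 powr (1/8 * sqrt (real n)) \<le> 2 powr (sqrt (real n) / 4 - 1/2) - 1"
    by real_asymp
  then show "\<forall>\<^sub>F n in sequentially. 2 powr (1/8 * sqrt (real n))
      \<le> real (extension_complexity (pverts (conflict_graph n)) (STAB (conflict_graph n)))"
  proof eventually_elim
    case (elim n)
    define r where "r = extension_complexity {..<n} (STAB (conflict_graph n))"
    \<comment> \<open>The largest \<open>m\<close> with
      \<open>(2 * m)\<^sup>2 \<le> n\<close>.\<close>
    define m where "m = nat \<lfloor>sqrt (real n) / 2\<rfloor>"
    have "real m = of_int \<lfloor>sqrt (real n) / 2\<rfloor>" by (simp add: m_def)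
    then have m: "real m \<le> sqrt (real n) / 2" "sqrt (real n) / 2 - 1 \<le> real m"
      by linarith+
    have "real ((2 * m)\<^sup>2) \<le> (sqrt (real n))\<^sup>2"
      using m(1) unfolding of_nat_power by (intro power_mono) auto
    then have "(2 * m)\<^sup>2 \<le> n" by (simp only: real_sqrt_pow2 of_nat_0_le_iff of_nat_le_iff)
    from extension_complexity_conflict_graph[OF this] have "3 ^ m \<le> (r + 1) * 2 ^ m"
      by (simp add: r_def)
    then have "real (3 ^ m) \<le> real ((r + 1) * 2 ^ m)" by (rule of_nat_mono)
    then have r: "(3 / 2) ^ m \<le> real r + 1"
      by (simp add: divide_simps algebra_simps power_divide)
    \<comment> \<open>The base 3/2 is weakened to \<open>sqrt 2\<close>, which turns the bound into
      a power of 2.\<close>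
    have "2 powr (sqrt (real n) / 4 - 1/2) \<le> 2 powr (1/2 * real m)"
      using m(2) by (intro powr_mono) auto
    also have "\<dots> = sqrt 2 ^ m"
      by (subst powr_powr[symmetric]) (simp add: powr_half_sqrt powr_realpow)
    also have "\<dots> \<le> (3 / 2) ^ m"
      by (intro power_mono real_le_lsqrt) (auto simp: power2_eq_square)
    finally show ?case using elim r by (simp add: r_def)
  qed
qed auto

end
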